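(* Let $X$ be a reflexive Banach space, let $T,A\in K(X)$ with $T\ne0$, and let $\varepsilon\in[0,1)$. Then $T\perp_B^\varepsilon A$ in $K(X)$ if and only if \[ \operatorname{conv}\{y^*(Ax):\ x\in M_T,\ y^*\in J(Tx)\}\cap B(0,\varepsilon\|A\|)\ne\emptyset. \]
   Context: All normed linear spaces are over $\mathbb{C}$. $K(X)$ is the space of compact linear operators $X\to X$ with the operator norm. $B_X$ is the closed unit ball of $X$, and $S_{X^*}$ is the unit sphere of the dual $X^*$. For $T\in K(X)$, $M_T=\{x\in B_X:\|Tx\|=\|T\|\}$. For non-zero $v\in X$, $J(v)=\{f\in S_{X^*}: f(v)=\|v\|\}$. $\operatorname{conv}$ denotes the convex hull in $\mathbb{C}$, and $B(0,r)=\{z\in\mathbb{C}:|z|\le r\}$ for $r\ge0$ (so $B(0,0)=\{0\}$). For a normed linear space $Z$, $u,v\in Z$ with $u \neq 0$ and $\varepsilon\in[0,1)$, Chmieli\'nski's approximate Birkhoff--James orthogonality $u\perp_B^\varepsilon v$ means that $\|u+\lambda v\|^2\ge\|u\|^2-2\varepsilon\|u\|\|\lambda v\|$ for all scalars $\lambda$; equivalently, there exists $f\in Z^*$ with $\|f\|=1$, $f(u)=\|u\|$ and $|f(v)|\le\varepsilon\|v\|$. *)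

theory Defs
  imports "HOL-Analysis.Analysis"
begin

section \<open>Complex normed spaces\<close>

class scaleC = scaleR +
  fixes scaleC :: "complex \<Rightarrow> 'a \<Rightarrow> 'a"  (infixr \<open>*\<^sub>C\<close> 75)
  assumes scaleR_scaleC: "r *\<^sub>R x = complex_of_real r *\<^sub>C x"

class complex_vector = scaleC + ab_group_add +
  assumes scaleC_add_right: "a *\<^sub>C (x + y) = a *\<^sub>C x + a *\<^sub>C y"
    and scaleC_add_left: "(a + b) *\<^sub>C x = a *\<^sub>C x + b *\<^sub>C x"
    and scaleC_scaleC: "a *\<^sub>C (b *\<^sub>C x) = (a * b) *\<^sub>C x"
    and scaleC_one: "1 *\<^sub>C x = x"

class complex_normed_vector = complex_vector + real_normed_vector +
  assumes norm_scaleC: "norm (a *\<^sub>C x) = cmod a * norm x"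

class complex_banach = complex_normed_vector + complete_space

subclass (in complex_banach) banach ..

instantiation complex :: complex_banach
begin

definition scaleC_complex :: "complex \<Rightarrow> complex \<Rightarrow> complex"
  where "scaleC_complex a z = a * z"

instance
  by standard (simp_all add: scaleC_complex_def scaleR_conv_of_real algebra_simps norm_mult)

end

lemma bounded_linear_scaleC:
  "bounded_linear (\<lambda>x. c *\<^sub>C x :: 'a::complex_normed_vector)"
proof (rule bounded_linear_intro[where K = "cmod c"])
  show "c *\<^sub>C (r *\<^sub>R x) = r *\<^sub>R (c *\<^sub>C x)" for r and x :: 'a
    by (simp add: scaleR_scaleC scaleC_scaleC mult.commute)
qed (simp_all add: scaleC_add_right norm_scaleC mult.commute)

lift_definition blinfun_scaleC ::
    "complex \<Rightarrow> 'a::real_normed_vector \<Rightarrow>\<^sub>L 'b::complex_normed_vector \<Rightarrow> 'a \<Rightarrow>\<^sub>L 'b"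
  is "\<lambda>c f x. c *\<^sub>C f x"
  by (rule bounded_linear_compose[OF bounded_linear_scaleC])

lemma scaleC_zero_right: "c *\<^sub>C (0 :: 'a::complex_normed_vector) = 0"
  by (rule linear_simps(3)[OF bounded_linear_scaleC])

lemma scaleC_minus_right: "c *\<^sub>C (- x) = - (c *\<^sub>C x)" for x :: "'a::complex_normed_vector"
  by (rule linear_simps(4)[OF bounded_linear_scaleC])

lemma scaleC_diff_right: "c *\<^sub>C (x - y) = c *\<^sub>C x - c *\<^sub>C y" for x :: "'a::complex_normed_vector"
  by (rule linear_simps(2)[OF bounded_linear_scaleC])


section \<open>Bounded complex-linear maps\<close>

typedef (overloaded) ('a, 'b) cblinfun (\<open>(_ \<Rightarrow>\<^sub>C\<^sub>L /_)\<close> [22, 21] 21) =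
  "{f :: 'a::complex_normed_vector \<Rightarrow>\<^sub>L 'b::complex_normed_vector.
      \<forall>c x. blinfun_apply f (c *\<^sub>C x) = c *\<^sub>C blinfun_apply f x}"
  morphisms blinfun_of_cblinfun Cblinfun
  by (rule exI[of _ 0]) (simp add: scaleC_zero_right)

setup_lifting type_definition_cblinfun

lift_definition cblinfun_apply :: "('a::complex_normed_vector \<Rightarrow>\<^sub>C\<^sub>L 'b::complex_normed_vector) \<Rightarrow> 'a \<Rightarrow> 'b"
  is blinfun_apply .

instantiation cblinfun :: (complex_normed_vector, complex_normed_vector) complex_normed_vector
begin

lift_definition zero_cblinfun :: "'a \<Rightarrow>\<^sub>C\<^sub>L 'b" is 0
  by (simp add: scaleC_zero_right)

lift_definition plus_cblinfun :: "'a \<Rightarrow>\<^sub>C\<^sub>L 'b \<Rightarrow> 'a \<Rightarrow>\<^sub>C\<^sub>L 'b \<Rightarrow> 'a \<Rightarrow>\<^sub>C\<^sub>L 'b" is "(+)"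
  by (simp add: blinfun.add_left scaleC_add_right)

lift_definition minus_cblinfun :: "'a \<Rightarrow>\<^sub>C\<^sub>L 'b \<Rightarrow> 'a \<Rightarrow>\<^sub>C\<^sub>L 'b \<Rightarrow> 'a \<Rightarrow>\<^sub>C\<^sub>L 'b" is "(-)"
  by (simp add: blinfun.diff_left scaleC_diff_right)

lift_definition uminus_cblinfun :: "'a \<Rightarrow>\<^sub>C\<^sub>L 'b \<Rightarrow> 'a \<Rightarrow>\<^sub>C\<^sub>L 'b" is uminus
  by (simp add: blinfun.minus_left scaleC_minus_right)

lift_definition scaleR_cblinfun :: "real \<Rightarrow> 'a \<Rightarrow>\<^sub>C\<^sub>L 'b \<Rightarrow> 'a \<Rightarrow>\<^sub>C\<^sub>L 'b" is scaleR
  by (simp add: blinfun.scaleR_left scaleR_scaleC scaleC_scaleC mult.commute)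

lift_definition scaleC_cblinfun :: "complex \<Rightarrow> 'a \<Rightarrow>\<^sub>C\<^sub>L 'b \<Rightarrow> 'a \<Rightarrow>\<^sub>C\<^sub>L 'b" is blinfun_scaleC
  by (simp add: blinfun_scaleC.rep_eq scaleC_scaleC mult.commute)

lift_definition norm_cblinfun :: "'a \<Rightarrow>\<^sub>C\<^sub>L 'b \<Rightarrow> real" is norm .

definition dist_cblinfun :: "'a \<Rightarrow>\<^sub>C\<^sub>L 'b \<Rightarrow> 'a \<Rightarrow>\<^sub>C\<^sub>L 'b \<Rightarrow> real"
  where "dist_cblinfun f g = norm (f - g)"

definition uniformity_cblinfun :: "(('a \<Rightarrow>\<^sub>C\<^sub>L 'b) \<times> ('a \<Rightarrow>\<^sub>C\<^sub>L 'b)) filter"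
  where "uniformity_cblinfun = (INF e\<in>{0 <..}. principal {(x, y). dist x y < e})"

definition open_cblinfun :: "('a \<Rightarrow>\<^sub>C\<^sub>L 'b) set \<Rightarrow> bool"
  where "open_cblinfun S = (\<forall>x\<in>S. \<forall>\<^sub>F (x', y) in uniformity. x' = x \<longrightarrow> y \<in> S)"

definition sgn_cblinfun :: "'a \<Rightarrow>\<^sub>C\<^sub>L 'b \<Rightarrow> 'a \<Rightarrow>\<^sub>C\<^sub>L 'b"
  where "sgn_cblinfun f = scaleR (inverse (norm f)) f"

instance
proof
  fix f g h :: "'a \<Rightarrow>\<^sub>C\<^sub>L 'b" and a b :: complex and r s :: real
  show "r *\<^sub>R f = complex_of_real r *\<^sub>C f"
    by transfer (auto intro!: blinfun_eqI simp: blinfun_scaleC.rep_eq blinfun.scaleR_left scaleR_scaleC)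
  show "a *\<^sub>C (f + g) = a *\<^sub>C f + a *\<^sub>C g"
    by transfer (auto intro!: blinfun_eqI simp: blinfun_scaleC.rep_eq blinfun.add_left scaleC_add_right)
  show "(a + b) *\<^sub>C f = a *\<^sub>C f + b *\<^sub>C f"
    by transfer (auto intro!: blinfun_eqI simp: blinfun_scaleC.rep_eq blinfun.add_left scaleC_add_left)
  show "a *\<^sub>C b *\<^sub>C f = (a * b) *\<^sub>C f"
    by transfer (auto intro!: blinfun_eqI simp: blinfun_scaleC.rep_eq scaleC_scaleC)
  show "1 *\<^sub>C f = f"
    by transfer (auto intro!: blinfun_eqI simp: blinfun_scaleC.rep_eq scaleC_one)
  show "norm (a *\<^sub>C f) = cmod a * norm f"
  proof transfer
    fix a :: complex and f :: "'a \<Rightarrow>\<^sub>L 'b"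
    have "norm (blinfun_scaleC a f) = onorm (\<lambda>x. cmod a *\<^sub>R blinfun_apply f x)"
      by (simp add: norm_blinfun.rep_eq blinfun_scaleC.rep_eq onorm_def norm_scaleC)
    also have "\<dots> = cmod a * norm f"
      by (subst onorm_scaleR) (auto simp: norm_blinfun.rep_eq intro: blinfun.bounded_linear_right)
    finally show "norm (blinfun_scaleC a f) = cmod a * norm f" .
  qed
  show "norm (f + g) \<le> norm f + norm g" by transfer (rule norm_triangle_ineq)
qed (unfold dist_cblinfun_def open_cblinfun_def sgn_cblinfun_def uniformity_cblinfun_def,
     (rule refl | (transfer, simp add: algebra_simps))+)

end


section \<open>Reflexivity and compact operators\<close>

lemma norm_cblinfun_apply: "norm (cblinfun_apply f x) \<le> norm f * norm x"
  by transfer (rule norm_blinfun)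

lemma scaleC_cblinfun_apply: "cblinfun_apply (c *\<^sub>C f) x = c *\<^sub>C cblinfun_apply f x"
  by transfer (simp add: blinfun_scaleC.rep_eq)

lemma bounded_linear_cblinfun_eval:
  "bounded_linear (\<lambda>f :: 'a::complex_normed_vector \<Rightarrow>\<^sub>C\<^sub>L 'b::complex_normed_vector. cblinfun_apply f x)"
proof (rule bounded_linear_intro[where K = "norm x"])
  show "cblinfun_apply (f + g) x = cblinfun_apply f x + cblinfun_apply g x"
    for f g :: "'a \<Rightarrow>\<^sub>C\<^sub>L 'b"
    by transfer (simp add: blinfun.add_left)
  show "cblinfun_apply (r *\<^sub>R f) x = r *\<^sub>R cblinfun_apply f x" for r and f :: "'a \<Rightarrow>\<^sub>C\<^sub>L 'b"
    by transfer (simp add: blinfun.scaleR_left)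
qed (rule norm_cblinfun_apply)

lift_definition dual_embed :: "'a::complex_normed_vector \<Rightarrow> ('a \<Rightarrow>\<^sub>C\<^sub>L complex) \<Rightarrow>\<^sub>C\<^sub>L complex"
  is "\<lambda>x. Blinfun (\<lambda>f. cblinfun_apply f x)"
  by (simp only: bounded_linear_Blinfun_apply[OF bounded_linear_cblinfun_eval]
      scaleC_cblinfun_apply simp_thms)

lemma dual_embed_apply: "cblinfun_apply (dual_embed x) f = cblinfun_apply f x"
  by (simp add: cblinfun_apply.rep_eq[of "dual_embed x"] dual_embed.rep_eq
      bounded_linear_Blinfun_apply[OF bounded_linear_cblinfun_eval])

definition reflexive_space :: "'a::complex_normed_vector itself \<Rightarrow> bool"
  where "reflexive_space _ \<longleftrightarrow> surj (dual_embed :: 'a \<Rightarrow> ('a \<Rightarrow>\<^sub>C\<^sub>L complex) \<Rightarrow>\<^sub>C\<^sub>L complex)"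

definition compact_operators :: "('a::complex_normed_vector \<Rightarrow>\<^sub>C\<^sub>L 'a) set"
  where "compact_operators = {T. compact (closure (cblinfun_apply T ` cball 0 1))}"


section \<open>Norm attainment, supporting functionals, approximate orthogonality\<close>

definition norm_attainment_set :: "('a::complex_normed_vector \<Rightarrow>\<^sub>C\<^sub>L 'a) \<Rightarrow> 'a set"
  where "norm_attainment_set T = {x \<in> cball 0 1. norm (cblinfun_apply T x) = norm T}"

definition support_functionals :: "'a::complex_normed_vector \<Rightarrow> ('a \<Rightarrow>\<^sub>C\<^sub>L complex) set"
  where "support_functionals v = {f \<in> sphere 0 1. cblinfun_apply f v = complex_of_real (norm v)}"

text \<open>The inequality mentions only the linear span of \<open>u\<close> and \<open>v\<close>. For compact operators, orthogonality
  in the space of compact operators is therefore the same as in the space of all bounded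
  operators, the norm being the operator norm in both.\<close>

definition approx_BJ_orthogonal :: "real \<Rightarrow> 'a::complex_normed_vector \<Rightarrow> 'a \<Rightarrow> bool"
  where "approx_BJ_orthogonal \<epsilon> u v \<longleftrightarrow>
    (\<forall>c. (norm (u + c *\<^sub>C v))\<^sup>2 \<ge> (norm u)\<^sup>2 - 2 * \<epsilon> * norm u * norm (c *\<^sub>C v))"

end

theory Submission
  imports Defs
begin

text \<open>Write \<open>W\<close> for the set of values \<open>y\<^sup>*(Ax)\<close> with \<open>x \<in> M\<^sub>T\<close> and \<open>y\<^sup>* \<in> J(Tx)\<close>.

  If \<open>z\<close> lies in the convex hull of \<open>W\<close>, then averaging the functionals \<open>S \<mapsto> y\<^sup>*(Sx)\<close> gives
  \<open>\<bar>\<parallel>T\<parallel> + c z\<bar> \<le> \<parallel>T + c A\<parallel>\<close> for all scalars \<open>c\<close> (\<open>norm_perturbed_ge_hull_value\<close>); when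
  \<open>\<bar>z\<bar> \<le> \<epsilon> \<parallel>A\<parallel>\<close> this yields the orthogonality inequality.

  Conversely, assume orthogonality and fix a direction \<open>\<mu>\<close> of modulus one. For small \<open>t > 0\<close>, a
  vector \<open>x\<close> and a functional \<open>y\<close> that almost norm \<open>T + t \<mu> A\<close> also almost norm \<open>T\<close>, and comparing
  the norms of \<open>T + t \<mu> A\<close> and \<open>T\<close> to first order in \<open>t\<close> shows that \<open>Re (\<mu> y(Ax))\<close> is at least
  \<open>- \<epsilon> \<parallel>A\<parallel>\<close> up to a term that vanishes with \<open>t\<close>. In the limit \<open>t \<rightarrow> 0\<close> one obtains a point
  \<open>w \<in> W\<close> with \<open>Re (\<mu> w) \<ge> - \<epsilon> \<parallel>A\<parallel>\<close> (\<open>approx_BJ_orthogonal_norming_value\<close>). The set \<open>W\<close> is compact,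
  so its convex hull is closed, and a closed convex subset of the plane that meets all these half
  planes meets the disc of radius \<open>\<epsilon> \<parallel>A\<parallel>\<close>: otherwise its point nearest to the origin would provide
  a direction \<open>\<mu>\<close> violating the bound (\<open>convex_meets_disc\<close>).

  Both the limit \<open>t \<rightarrow> 0\<close> and the compactness of \<open>W\<close> come from one fact
  (\<open>compact_operators_attain_limits\<close>): limits of \<open>y\<^sub>n(Tx\<^sub>n)\<close> and \<open>y\<^sub>n(Ax\<^sub>n)\<close>, with \<open>x\<^sub>n\<close> and \<open>y\<^sub>n\<close>
  in the unit balls, are attained at a single pair \<open>(x, y)\<close>. Classically this is weak compactness of
  the two balls. Here a generalized limit takes its place: the upper limit is a sublinear functional,
  so the Hahn-Banach theorem turns a bounded sequence of functionals into a single functional that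
  agrees with the pointwise limit wherever this exists. Reflexivity makes the same construction
  available for the vectors \<open>x\<^sub>n\<close>, viewed as functionals on the dual.\<close>

section \<open>The Hahn-Banach theorem\<close>

text \<open>Positive homogeneity is only required as an inequality, which is what one can check directly for a
  functional defined as an infimum; equality follows (\<open>sublinear_scale\<close>).\<close>

definition sublinear :: "('a::real_vector \<Rightarrow> real) \<Rightarrow> bool"
  where "sublinear p \<longleftrightarrow>
    (\<forall>x y. p (x + y) \<le> p x + p y) \<and> (\<forall>t x. 0 \<le> t \<longrightarrow> p (t *\<^sub>R x) \<le> t * p x)"

lemma sublinearI:
  assumes "\<And>x y. p (x + y) \<le> p x + p y" "\<And>t x. 0 \<le> t \<Longrightarrow> p (t *\<^sub>R x) \<le> t * p x"
  shows "sublinear p"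
  using assms by (auto simp: sublinear_def)

lemma sublinear_add: "sublinear p \<Longrightarrow> p (x + y) \<le> p x + p y"
  by (simp add: sublinear_def)

lemma sublinear_zero:
  assumes "sublinear p" shows "p 0 = 0"
proof -
  have "p (0 *\<^sub>R 0) \<le> 0 * p 0" "p (0 + 0) \<le> p 0 + p 0"
    using assms unfolding sublinear_def by blast+
  then show ?thesis by simp
qed

lemma sublinear_scale:
  assumes "sublinear p" "0 \<le> t" shows "p (t *\<^sub>R x) = t * p x"
proof (cases "t = 0")
  case True
  then show ?thesis by (simp add: sublinear_zero[OF assms(1)])
next
  case False
  then have "0 < t" using assms by simp
  have "p (inverse t *\<^sub>R (t *\<^sub>R x)) \<le> inverse t * p (t *\<^sub>R x)"
    using assms unfolding sublinear_def by (meson inverse_nonnegative_iff_nonnegative)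
  then have "t * p x \<le> p (t *\<^sub>R x)"
    using \<open>0 < t\<close> by (simp add: field_simps)
  moreover have "p (t *\<^sub>R x) \<le> t * p x"
    using assms by (simp add: sublinear_def)
  ultimately show ?thesis by simp
qed

lemma sublinear_ge_minus: "sublinear p \<Longrightarrow> - p (- x) \<le> p x"
  using sublinear_add[of p x "- x"] sublinear_zero[of p] by simp

text \<open>The infimum of \<open>p (x + t v) - t p v\<close> over \<open>t \<ge> 0\<close> lowers \<open>p\<close> at \<open>- v\<close> to the
  value \<open>- p v\<close> that any linear functional agreeing with \<open>p\<close> at \<open>v\<close> takes there. It serves twice: to
  prescribe the value of the Hahn-Banach functional at \<open>v\<close>, and to show that a minimal sublinear
  functional is odd, hence linear.\<close>

lemma sublinear_tilt:
  assumes p: "sublinear p"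
  obtains q where "sublinear q" "q \<le> p" "q (- v) \<le> - p v"
proof
  define D where "D x = (\<lambda>t. p (x + t *\<^sub>R v) - t * p v) ` {0..}" for x
  define q where "q x = Inf (D x)" for x
  have bdd: "bdd_below (D x)" for x
  proof (rule bdd_belowI)
    fix r assume "r \<in> D x"
    then obtain t where "0 \<le> t" "r = p (x + t *\<^sub>R v) - t * p v" by (auto simp: D_def)
    then show "- p (- x) \<le> r"
      using sublinear_add[OF p, of "x + t *\<^sub>R v" "- x"] sublinear_scale[OF p, of t v] by simp
  qed
  have ne: "D x \<noteq> {}" for x by (auto simp: D_def)
  have le: "q x \<le> p (x + t *\<^sub>R v) - t * p v" if "0 \<le> t" for t x
    unfolding q_def by (rule cInf_lower[OF _ bdd]) (use that in \<open>auto simp: D_def\<close>)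
  show "sublinear q"
  proof (rule sublinearI)
    fix x y
    have *: "q (x + y) \<le> r + s" if "r \<in> D x" "s \<in> D y" for r s
    proof -
      obtain t u where tu: "0 \<le> t" "r = p (x + t *\<^sub>R v) - t * p v"
        "0 \<le> u" "s = p (y + u *\<^sub>R v) - u * p v"
        using \<open>r \<in> D x\<close> \<open>s \<in> D y\<close> by (auto simp: D_def)
      have "q (x + y) \<le> p ((x + y) + (t + u) *\<^sub>R v) - (t + u) * p v"
        using tu by (intro le) simp
      also have "(x + y) + (t + u) *\<^sub>R v = (x + t *\<^sub>R v) + (y + u *\<^sub>R v)"
        by (simp add: algebra_simps)
      finally show ?thesis
        using sublinear_add[OF p, of "x + t *\<^sub>R v" "y + u *\<^sub>R v"] tu by (simp add: algebra_simps)
    qed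
    have "q (x + y) - s \<le> q x" if "s \<in> D y" for s
      unfolding q_def[of x] by (rule cInf_greatest[OF ne]) (use *[OF _ that] in fastforce)
    then have "q (x + y) - q x \<le> q y"
      unfolding q_def[of y] by (intro cInf_greatest[OF ne]) (fastforce simp: algebra_simps)
    then show "q (x + y) \<le> q x + q y" by simp
  next
    fix t :: real and x assume "0 \<le> t"
    show "q (t *\<^sub>R x) \<le> t * q x"
    proof (cases "t = 0")
      case True
      then show ?thesis using le[of 0 0] sublinear_zero[OF p] by simp
    next
      case False
      then have "0 < t" using \<open>0 \<le> t\<close> by simp
      have "q (t *\<^sub>R x) / t \<le> q x"
        unfolding q_def[of x]
      proof (rule cInf_greatest[OF ne])
        fix r assume "r \<in> D x"
        then obtain u where u: "0 \<le> u" "r = p (x + u *\<^sub>R v) - u * p v" by (auto simp: D_def)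
        have "q (t *\<^sub>R x) \<le> p (t *\<^sub>R x + (t * u) *\<^sub>R v) - (t * u) * p v"
          using u \<open>0 < t\<close> by (intro le) simp
        also have "t *\<^sub>R x + (t * u) *\<^sub>R v = t *\<^sub>R (x + u *\<^sub>R v)"
          by (simp add: algebra_simps)
        also have "p (t *\<^sub>R (x + u *\<^sub>R v)) - (t * u) * p v = t * r"
          using u by (simp add: sublinear_scale[OF p \<open>0 \<le> t\<close>] right_diff_distrib)
        finally show "q (t *\<^sub>R x) / t \<le> r" using \<open>0 < t\<close> by (simp add: field_simps)
      qed
      then show ?thesis using \<open>0 < t\<close> by (simp add: field_simps)
    qed
  qed
  show "q \<le> p" using le[of 0] by (simp add: le_fun_def)
  show "q (- v) \<le> - p v" using le[of 1 "- v"] sublinear_zero[OF p] by simp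
qed

text \<open>Zorn's lemma for the reversed pointwise order. The infimum of a chain is finite because
  \<open>- p (- x)\<close> bounds every sublinear functional below \<open>p\<close> from below, and it is subadditive because
  two members of a chain can be replaced by the smaller one.\<close>

lemma minimal_sublinear_below:
  assumes p: "sublinear p"
  obtains m where "sublinear m" "m \<le> p" "\<And>q. sublinear q \<Longrightarrow> q \<le> m \<Longrightarrow> q = m"
proof -
  define Q where "Q = {q. sublinear q \<and> q \<le> p}"
  have "\<exists>m\<in>Q. \<forall>q\<in>Q. q \<le> m \<longrightarrow> q = m"
  proof (rule predicate_Zorn)
    show "partial_order_on Q (relation_of (\<lambda>q r. r \<le> q) Q)"
      by (rule partial_order_on_relation_ofI) auto
    fix C assume C: "C \<in> Chains (relation_of (\<lambda>q r. r \<le> q) Q)"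
    show "\<exists>u\<in>Q. \<forall>q\<in>C. u \<le> q"
    proof (cases "C = {}")
      case True
      then show ?thesis using p by (auto simp: Q_def)
    next
      case False
      have CQ: "sublinear q" "q \<le> p" if "q \<in> C" for q
        using Chains_relation_of[OF C] that by (auto simp: Q_def)
      have chain: "q \<le> r \<or> r \<le> q" if "q \<in> C" "r \<in> C" for q r
        using C that unfolding Chains_def relation_of_def by auto
      have bdd: "bdd_below ((\<lambda>q. q x) ` C)" for x
      proof (rule bdd_belowI2)
        fix q assume "q \<in> C"
        have "q (- x) \<le> p (- x)" using CQ[OF \<open>q \<in> C\<close>] by (simp add: le_fun_def)
        then show "- p (- x) \<le> q x"
          using sublinear_ge_minus[OF CQ(1)[OF \<open>q \<in> C\<close>], of x] by simp
      qed
      define u where "u x = (INF q\<in>C. q x)" for x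
      have le: "u x \<le> q x" if "q \<in> C" for q x
        unfolding u_def by (rule cINF_lower[OF bdd that])
      have "sublinear u"
      proof (rule sublinearI)
        fix x y
        have *: "u (x + y) \<le> q x + r y" if qr: "q \<in> C" "r \<in> C" for q r
        proof -
          obtain s where s: "s \<in> C" "s \<le> q" "s \<le> r" using chain[OF qr] qr by blast
          have "u (x + y) \<le> s (x + y)" by (rule le[OF s(1)])
          also have "\<dots> \<le> s x + s y" by (rule sublinear_add[OF CQ(1)[OF s(1)]])
          also have "\<dots> \<le> q x + r y" using s by (intro add_mono) (auto simp: le_fun_def)
          finally show ?thesis .
        qed
        have "u (x + y) - r y \<le> u x" if "r \<in> C" for r
          unfolding u_def[of x] by (rule cINF_greatest[OF False]) (use *[OF _ that] in fastforce)
        then have "u (x + y) - u x \<le> u y"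
          unfolding u_def[of y] by (intro cINF_greatest[OF False]) (fastforce simp: algebra_simps)
        then show "u (x + y) \<le> u x + u y" by simp
      next
        fix t :: real and x assume "0 \<le> t"
        show "u (t *\<^sub>R x) \<le> t * u x"
        proof (cases "t = 0")
          case True
          obtain q where q: "q \<in> C" using False by blast
          then show ?thesis using le[OF q, of 0] sublinear_zero[OF CQ(1)[OF q]] True by simp
        next
          case nz: False
          then have "0 < t" using \<open>0 \<le> t\<close> by simp
          have "u (t *\<^sub>R x) / t \<le> u x"
            unfolding u_def[of x]
          proof (rule cINF_greatest[OF False])
            fix q assume "q \<in> C"
            then show "u (t *\<^sub>R x) / t \<le> q x"
              using le[of q "t *\<^sub>R x"] sublinear_scale[OF CQ(1) \<open>0 \<le> t\<close>, of q x] \<open>0 < t\<close>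
              by (simp add: field_simps)
          qed
          then show ?thesis using \<open>0 < t\<close> by (simp add: field_simps)
        qed
      qed
      moreover have "u \<le> p"
      proof -
        obtain q where "q \<in> C" using False by blast
        then show ?thesis using le CQ(2) by (meson le_fun_def order_trans)
      qed
      ultimately show ?thesis using le by (auto simp: Q_def le_fun_def)
    qed
  qed
  then obtain m where m: "m \<in> Q" "\<And>q. q \<in> Q \<Longrightarrow> q \<le> m \<Longrightarrow> q = m" by blast
  show thesis
  proof
    show "sublinear m" "m \<le> p" using m(1) by (auto simp: Q_def)
    show "q = m" if "sublinear q" "q \<le> m" for q
      using m that by (auto simp: Q_def intro: order_trans)
  qed
qed

text \<open>A minimal sublinear functional cannot be tilted any further in any direction, so it is odd; an odd
  sublinear functional is linear. Tilting \<open>p\<close> at \<open>v\<close> before minimizing forces equality at \<open>v\<close>.\<close>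

theorem hahn_banach_sublinear:
  fixes p :: "'a::real_vector \<Rightarrow> real"
  assumes p: "sublinear p"
  obtains f where "linear f" "\<And>x. f x \<le> p x" "f v = p v"
proof -
  obtain q where q: "sublinear q" "q \<le> p" "q (- v) \<le> - p v"
    by (rule sublinear_tilt[OF p])
  obtain f where f: "sublinear f" "f \<le> q" and min: "\<And>r. sublinear r \<Longrightarrow> r \<le> f \<Longrightarrow> r = f"
    using minimal_sublinear_below[OF q(1)] by blast
  have odd: "f (- w) = - f w" for w
  proof -
    obtain r where r: "sublinear r" "r \<le> f" "r (- w) \<le> - f w"
      by (rule sublinear_tilt[OF f(1)])
    then have "f (- w) \<le> - f w" using min[OF r(1,2)] by simp
    then show ?thesis using sublinear_ge_minus[OF f(1), of w] by simp
  qed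
  show thesis
  proof
    show "linear f"
    proof (rule linearI)
      show "f (x + y) = f x + f y" for x y
        using sublinear_add[OF f(1), of x y] sublinear_add[OF f(1), of "- x" "- y"] odd[of "x + y"]
        by (simp add: odd)
      show "f (t *\<^sub>R x) = t *\<^sub>R f x" for t x
        using sublinear_scale[OF f(1), of t x] sublinear_scale[OF f(1), of "- t" x]
          odd[of "t *\<^sub>R x"] by (cases "0 \<le> t") auto
    qed
    show le: "f x \<le> p x" for x using f(2) q(2) by (meson le_fun_def order_trans)
    have "f (- v) \<le> - p v" using f(2) q(3) by (meson le_fun_def order_trans)
    then show "f v = p v" using le[of v] by (simp add: odd)
  qed
qed

section \<open>Complex functionals\<close>

lemma cblinfun_apply_add: "cblinfun_apply f (x + y) = cblinfun_apply f x + cblinfun_apply f y"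
  by transfer (simp add: blinfun.add_right)

lemma cblinfun_apply_scaleC: "cblinfun_apply f (c *\<^sub>C x) = c *\<^sub>C cblinfun_apply f x"
  by transfer simp

lemma cblinfun_add_apply: "cblinfun_apply (f + g) x = cblinfun_apply f x + cblinfun_apply g x"
  by transfer (simp add: blinfun.add_left)

lemma bounded_linear_cblinfun_apply: "bounded_linear (cblinfun_apply f)"
  by transfer (rule blinfun.bounded_linear_right)

lemma norm_cblinfun_le:
  "0 \<le> K \<Longrightarrow> (\<And>x. norm (cblinfun_apply f x) \<le> K * norm x) \<Longrightarrow> norm f \<le> K"
  by transfer (rule norm_blinfun_bound)

lemma norm_cblinfun_apply_le:
  assumes "norm f \<le> K" "norm x \<le> 1" shows "norm (cblinfun_apply f x) \<le> K"
proof -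
  have "norm f * norm x \<le> K * 1"
    using assms order_trans[OF norm_ge_zero assms(1)] by (intro mult_mono) auto
  then show ?thesis using norm_cblinfun_apply[of f x] by simp
qed

lemma cblinfun_exists:
  fixes h :: "'a::complex_normed_vector \<Rightarrow> 'b::complex_normed_vector"
  assumes add: "\<And>x y. h (x + y) = h x + h y" and scale: "\<And>c x. h (c *\<^sub>C x) = c *\<^sub>C h x"
    and bound: "\<And>x. norm (h x) \<le> K * norm x" and "0 \<le> K"
  obtains f where "\<And>x. cblinfun_apply f x = h x" "norm f \<le> K"
proof -
  have "bounded_linear h"
    by (rule bounded_linear_intro[where K = K])
      (simp_all add: add scaleR_scaleC scale bound mult.commute)
  then have *: "cblinfun_apply (Cblinfun (Blinfun h)) x = h x" for x
    by (simp add: cblinfun_apply.rep_eq Cblinfun_inverse bounded_linear_Blinfun_apply scale)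
  show thesis
    by (rule that[OF *]) (use * bound \<open>0 \<le> K\<close> in \<open>simp add: norm_cblinfun_le\<close>)
qed

text \<open>The usual complexification \<open>h x = f x - \<i> f (\<i> x)\<close> of a real functional \<open>f\<close>. A rotation that makes
  \<open>h x\<close> real and nonnegative reduces the bound on \<open>h\<close> to the bound on \<open>f\<close>.\<close>

theorem hahn_banach_complex:
  fixes p :: "'a::complex_normed_vector \<Rightarrow> real"
  assumes p: "sublinear p" and le_norm: "\<And>x. p x \<le> norm x"
  obtains F :: "'a \<Rightarrow>\<^sub>C\<^sub>L complex"
  where "norm F \<le> 1" "\<And>x. Re (cblinfun_apply F x) \<le> p x" "Re (cblinfun_apply F v) = p v"
proof -
  obtain f where f: "linear f" "\<And>x. f x \<le> p x" "f v = p v"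
    by (rule hahn_banach_sublinear[OF p, of v]) blast
  define h where "h x = Complex (f x) (- f (\<i> *\<^sub>C x))" for x
  have Re_h: "Re (h x) = f x" for x by (simp add: h_def)
  have add: "h (x + y) = h x + h y" for x y
    by (simp add: h_def scaleC_add_right linear_add[OF f(1)] complex_eq_iff)
  have fC: "f (c *\<^sub>C x) = Re c * f x + Im c * f (\<i> *\<^sub>C x)" for c x
  proof -
    have "c *\<^sub>C x = Re c *\<^sub>R x + Im c *\<^sub>R (\<i> *\<^sub>C x)"
      by (simp add: scaleR_scaleC scaleC_scaleC flip: scaleC_add_left)
        (metis complex_eq mult.commute)
    then show ?thesis by (simp add: linear_add[OF f(1)] linear_scale[OF f(1)])
  qed
  have scale: "h (c *\<^sub>C x) = c *\<^sub>C h x" for c x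
    by (simp add: h_def complex_eq_iff scaleC_complex_def scaleC_scaleC fC[of c] fC[of "\<i> * c"])
  have "norm (h x) \<le> 1 * norm x" for x
  proof -
    define u where "u = cnj (sgn (h x))"
    have "u * h x = complex_of_real (cmod (h x))"
      by (cases "h x = 0") (simp_all add: u_def sgn_eq complex_norm_square[symmetric]
          power2_eq_square mult.commute[of "cnj _"] field_simps)
    then have "cmod (h x) = Re (h (u *\<^sub>C x))" by (simp add: scale scaleC_complex_def)
    also have "\<dots> \<le> norm (u *\<^sub>C x)" unfolding Re_h by (rule order_trans[OF f(2) le_norm])
    also have "\<dots> \<le> 1 * norm x"
      unfolding norm_scaleC by (rule mult_right_mono) (auto simp: u_def norm_sgn)
    finally show ?thesis .
  qed
  then obtain F where F: "\<And>x. cblinfun_apply F x = h x" "norm F \<le> 1"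
    using cblinfun_exists[of h 1] add scale by (metis zero_le_one)
  show thesis by (rule that[of F]) (simp_all add: F Re_h f)
qed

lemma norming_functional:
  fixes v :: "'a::complex_normed_vector"
  obtains F :: "'a \<Rightarrow>\<^sub>C\<^sub>L complex"
  where "norm F \<le> 1" "cblinfun_apply F v = complex_of_real (norm v)"
proof -
  have "sublinear (norm :: 'a \<Rightarrow> real)"
    by (rule sublinearI) (simp_all add: norm_triangle_ineq)
  then obtain F :: "'a \<Rightarrow>\<^sub>C\<^sub>L complex" where F: "norm F \<le> 1" "Re (cblinfun_apply F v) = norm v"
    using hahn_banach_complex[of norm v] by auto
  have "cmod (cblinfun_apply F v) \<le> norm v"
    using norm_cblinfun_apply[of F v] mult_right_mono[OF F(1) norm_ge_zero[of v]] by simp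
  then have "cmod (cblinfun_apply F v) = Re (cblinfun_apply F v)"
    using F(2) complex_Re_le_cmod[of "cblinfun_apply F v"] by simp
  then have "cblinfun_apply F v = complex_of_real (norm v)"
    using F(2) by (metis Re_complex_of_real cmod_eq_Re cmod_power2 complex_eq_iff
        Im_complex_of_real add_cancel_right_right power_eq_0_iff zero_less_numeral)
  then show thesis using F(1) that by blast
qed

text \<open>A substitute for weak-star compactness of the dual ball. The infimum of the eventual upper bounds of
  \<open>Re (g\<^sub>n z)\<close>, that is its upper limit, is sublinear in \<open>z\<close>. A functional dominated by it has
  \<open>Re (F (a z)) \<le> Re (a l)\<close> for every scalar \<open>a\<close> whenever \<open>g\<^sub>n z\<close> converges to \<open>l\<close>, and this
  leaves only \<open>F z = l\<close>.\<close>

lemma generalized_limit_functional: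
  fixes g :: "nat \<Rightarrow> 'a::complex_normed_vector \<Rightarrow>\<^sub>C\<^sub>L complex"
  assumes g: "\<And>n. norm (g n) \<le> 1"
  obtains F where "norm F \<le> 1"
    "\<And>z l. (\<lambda>n. cblinfun_apply (g n) z) \<longlonglongrightarrow> l \<Longrightarrow> cblinfun_apply F z = l"
proof -
  define C where "C z = {c. \<forall>\<^sub>F n in sequentially. Re (cblinfun_apply (g n) z) \<le> c}" for z
  define p where "p z = Inf (C z)" for z
  have gz: "cmod (cblinfun_apply (g n) z) \<le> norm z" for n z
    using norm_cblinfun_apply[of "g n" z] mult_right_mono[OF g[of n] norm_ge_zero[of z]] by simp
  have norm_C: "norm z \<in> C z" for z
    unfolding C_def using order_trans[OF complex_Re_le_cmod gz] by simp
  have bdd: "bdd_below (C z)" for z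
  proof (rule bdd_belowI)
    fix c assume "c \<in> C z"
    then obtain n where "Re (cblinfun_apply (g n) z) \<le> c"
      by (auto simp: C_def dest: eventually_happens)
    moreover have "- norm z \<le> Re (cblinfun_apply (g n) z)"
      using abs_Re_le_cmod[of "cblinfun_apply (g n) z"] gz[of n z] by linarith
    ultimately show "- norm z \<le> c" by simp
  qed
  have le: "p z \<le> c" if "c \<in> C z" for c z
    unfolding p_def by (rule cInf_lower[OF that bdd])
  have ne: "C z \<noteq> {}" for z using norm_C by blast
  have "sublinear p"
  proof (rule sublinearI)
    fix z w
    have *: "p (z + w) \<le> c + d" if "c \<in> C z" "d \<in> C w" for c d
    proof (rule le)
      have "\<forall>\<^sub>F n in sequentially. Re (cblinfun_apply (g n) z) \<le> c \<and> Re (cblinfun_apply (g n) w) \<le> d"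
        using that by (simp add: C_def eventually_conj)
      then show "c + d \<in> C (z + w)"
        unfolding C_def by (auto elim!: eventually_mono simp: cblinfun_apply_add)
    qed
    have "p (z + w) - d \<le> p z" if "d \<in> C w" for d
      unfolding p_def[of z] by (rule cInf_greatest[OF ne]) (use *[OF _ that] in fastforce)
    then have "p (z + w) - p z \<le> p w"
      unfolding p_def[of w] by (intro cInf_greatest[OF ne]) (fastforce simp: algebra_simps)
    then show "p (z + w) \<le> p z + p w" by simp
  next
    fix t :: real and z assume "0 \<le> t"
    have *: "p (t *\<^sub>R z) \<le> t * c" if "c \<in> C z" for c
    proof (rule le)
      show "t * c \<in> C (t *\<^sub>R z)"
        using that \<open>0 \<le> t\<close> unfolding C_def
        by (auto elim!: eventually_mono intro: mult_left_mono
            simp: scaleR_scaleC cblinfun_apply_scaleC scaleC_complex_def)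
    qed
    show "p (t *\<^sub>R z) \<le> t * p z"
    proof (cases "t = 0")
      case True
      then show ?thesis using *[OF norm_C] by simp
    next
      case False
      then have "0 < t" using \<open>0 \<le> t\<close> by simp
      have "p (t *\<^sub>R z) / t \<le> p z"
        unfolding p_def[of z]
        by (rule cInf_greatest[OF ne]) (use * \<open>0 < t\<close> in \<open>simp add: field_simps\<close>)
      then show ?thesis using \<open>0 < t\<close> by (simp add: field_simps)
    qed
  qed
  then obtain F where F: "norm F \<le> 1" "\<And>z. Re (cblinfun_apply F z) \<le> p z"
    using hahn_banach_complex[of p 0] le[OF norm_C] by metis
  have "cblinfun_apply F z = l" if lim: "(\<lambda>n. cblinfun_apply (g n) z) \<longlonglongrightarrow> l" for z l
  proof -
    \<comment> \<open>By homogeneity the domination can be used at \<open>a z\<close>, along which the values converge to \<open>a l\<close>.\<close>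
    have Re_le: "Re (a * cblinfun_apply F z) \<le> Re (a * l)" for a
    proof (rule field_le_epsilon)
      fix e :: real assume "0 < e"
      have "(\<lambda>n. Re (a * cblinfun_apply (g n) z)) \<longlonglongrightarrow> Re (a * l)"
        by (intro tendsto_intros lim)
      then have "\<forall>\<^sub>F n in sequentially. Re (a * cblinfun_apply (g n) z) < Re (a * l) + e"
        using \<open>0 < e\<close> by (intro order_tendstoD) auto
      then have "Re (a * l) + e \<in> C (a *\<^sub>C z)"
        unfolding C_def by (auto elim!: eventually_mono simp: cblinfun_apply_scaleC scaleC_complex_def)
      then show "Re (a * cblinfun_apply F z) \<le> Re (a * l) + e"
        using F(2)[of "a *\<^sub>C z"] le by (fastforce simp: cblinfun_apply_scaleC scaleC_complex_def)
    qed
    define d where "d = cblinfun_apply F z - l"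
    have "Re (cnj d * d) \<le> 0"
      using Re_le[of "cnj d"] by (simp add: d_def right_diff_distrib)
    then have "d = 0"
      by (simp add: complex_eq_iff sum_power2_le_zero_iff flip: power2_eq_square)
    then show ?thesis by (simp add: d_def)
  qed
  with F(1) show thesis using that by blast
qed

section \<open>Compact operators on reflexive spaces\<close>

lemma complex_eq_of_real_if_Re_ge:
  assumes "cmod z \<le> r" "r \<le> Re z" shows "z = complex_of_real r"
proof -
  have eq: "cmod z = Re z" "Re z = r"
    using assms complex_Re_le_cmod[of z] by simp_all
  then have "Im z = 0" using cmod_power2[of z] by simp
  then show ?thesis using eq by (simp add: complex_eq_iff)
qed

lemma cblinfun_eqI_functionals:
  fixes u v :: "'a::complex_normed_vector"
  assumes "\<And>f :: 'a \<Rightarrow>\<^sub>C\<^sub>L complex. cblinfun_apply f u = cblinfun_apply f v"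
  shows "u = v"
proof -
  obtain f :: "'a \<Rightarrow>\<^sub>C\<^sub>L complex" where "cblinfun_apply f (u - v) = complex_of_real (norm (u - v))"
    by (rule norming_functional)
  moreover have "cblinfun_apply f (u - v) = 0"
    using assms by (simp add: linear_diff[OF bounded_linear.linear[OF bounded_linear_cblinfun_apply]])
  ultimately show ?thesis by simp
qed

lemma compact_operator_convergent_subsequence:
  assumes "T \<in> compact_operators" "\<And>n. norm (x n) \<le> 1"
  obtains r u where "strict_mono (r :: nat \<Rightarrow> nat)" "(\<lambda>n. cblinfun_apply T (x (r n))) \<longlonglongrightarrow> u"
proof -
  have "compact (closure (cblinfun_apply T ` cball 0 1))"
    using assms(1) by (simp add: compact_operators_def)
  moreover have "\<forall>n. cblinfun_apply T (x n) \<in> closure (cblinfun_apply T ` cball 0 1)"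
    using assms(2) closure_subset by (fastforce simp: image_iff)
  ultimately obtain u r where "strict_mono r" "((\<lambda>n. cblinfun_apply T (x n)) \<circ> r) \<longlonglongrightarrow> u"
    unfolding compact_def by meson
  then show thesis using that by (simp add: o_def)
qed

text \<open>A substitute for weak sequential compactness of the unit ball: the generalized limit of the \<open>x\<^sub>n\<close>
  in the bidual is evaluation at some vector \<open>x'\<close>. If \<open>S x\<^sub>n\<close> converges to \<open>u\<close>, then \<open>S x'\<close> and \<open>u\<close>
  agree under every functional.\<close>

lemma reflexive_common_limit:
  fixes x :: "nat \<Rightarrow> 'a::complex_normed_vector"
  assumes "reflexive_space TYPE('a)" and x: "\<And>n. norm (x n) \<le> 1"
  obtains x' where "norm x' \<le> 1"
    "\<And>(S :: 'a \<Rightarrow>\<^sub>C\<^sub>L 'a) u. (\<lambda>n. cblinfun_apply S (x n)) \<longlonglongrightarrow> u \<Longrightarrow> cblinfun_apply S x' = u"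
proof -
  have "norm (dual_embed (x n)) \<le> 1" for n
    by (rule norm_cblinfun_le)
      (simp_all add: dual_embed_apply order_trans[OF norm_cblinfun_apply] mult_left_le x)
  then obtain \<Phi> where \<Phi>: "norm \<Phi> \<le> 1" and lim_\<Phi>:
    "\<And>f l. (\<lambda>n. cblinfun_apply (dual_embed (x n)) f) \<longlonglongrightarrow> l \<Longrightarrow> cblinfun_apply \<Phi> f = l"
    using generalized_limit_functional[of "\<lambda>n. dual_embed (x n)"] by blast
  obtain x' where x': "\<Phi> = dual_embed x'"
    using assms(1) unfolding reflexive_space_def by blast
  have lim: "cblinfun_apply f x' = l" if "(\<lambda>n. cblinfun_apply f (x n)) \<longlonglongrightarrow> l"
    for f :: "'a \<Rightarrow>\<^sub>C\<^sub>L complex" and l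
    using lim_\<Phi>[of f l] that by (simp add: x' dual_embed_apply)
  show thesis
  proof
    obtain f :: "'a \<Rightarrow>\<^sub>C\<^sub>L complex"
      where f: "norm f \<le> 1" "cblinfun_apply f x' = complex_of_real (norm x')"
      by (rule norming_functional)
    have "norm (cblinfun_apply \<Phi> f) \<le> 1" by (rule norm_cblinfun_apply_le[OF \<Phi> f(1)])
    then show "norm x' \<le> 1" by (simp add: x' dual_embed_apply f)
  next
    fix S :: "'a \<Rightarrow>\<^sub>C\<^sub>L 'a" and u assume Su: "(\<lambda>n. cblinfun_apply S (x n)) \<longlonglongrightarrow> u"
    show "cblinfun_apply S x' = u"
    proof (rule cblinfun_eqI_functionals)
      fix f :: "'a \<Rightarrow>\<^sub>C\<^sub>L complex"
      have "norm (cblinfun_apply f (cblinfun_apply S z)) \<le> (norm f * norm S) * norm z" for z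
        using order_trans[OF norm_cblinfun_apply[of f "cblinfun_apply S z"]
            mult_left_mono[OF norm_cblinfun_apply[of S z] norm_ge_zero[of f]]]
        by (simp add: mult.assoc)
      then obtain fS :: "'a \<Rightarrow>\<^sub>C\<^sub>L complex"
        where fS: "\<And>z. cblinfun_apply fS z = cblinfun_apply f (cblinfun_apply S z)"
        using cblinfun_exists[of "\<lambda>z. cblinfun_apply f (cblinfun_apply S z)" "norm f * norm S"]
        by (metis (no_types, lifting) cblinfun_apply_add cblinfun_apply_scaleC mult_nonneg_nonneg norm_ge_zero)
      have "(\<lambda>n. cblinfun_apply fS (x n)) \<longlonglongrightarrow> cblinfun_apply f u"
        unfolding fS by (rule bounded_linear.tendsto[OF bounded_linear_cblinfun_apply Su])
      then show "cblinfun_apply f (cblinfun_apply S x') = cblinfun_apply f u"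
        using lim[of fS] by (simp add: fS)
    qed
  qed
qed

lemma functional_values_limit:
  assumes y: "\<And>n. norm (y n) \<le> 1" and u: "u \<longlonglongrightarrow> u'"
    and l: "(\<lambda>n. cblinfun_apply (y n) (u n)) \<longlonglongrightarrow> l"
  shows "(\<lambda>n. cblinfun_apply (y n) u') \<longlonglongrightarrow> l"
proof -
  have "(\<lambda>n. cblinfun_apply (y n) (u' - u n)) \<longlonglongrightarrow> 0"
  proof (rule Lim_null_comparison)
    have "norm (cblinfun_apply (y n) (u' - u n)) \<le> norm (u' - u n)" for n
      using norm_cblinfun_apply[of "y n" "u' - u n"]
        mult_right_mono[OF y[of n] norm_ge_zero[of "u' - u n"]] by simp
    then show "\<forall>\<^sub>F n in sequentially. norm (cblinfun_apply (y n) (u' - u n)) \<le> norm (u' - u n)"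
      by simp
    show "(\<lambda>n. norm (u' - u n)) \<longlonglongrightarrow> 0"
      using tendsto_norm[OF tendsto_diff[OF tendsto_const u], of u'] by simp
  qed
  from tendsto_add[OF this l] show ?thesis
    by (simp flip: cblinfun_apply_add)
qed

text \<open>Compactness of \<open>T\<close> and \<open>A\<close> lets \<open>T x\<^sub>n\<close> and \<open>A x\<^sub>n\<close> converge in norm along a common subsequence,
  to \<open>u\<close> and \<open>v\<close> say. Then \<open>y\<^sub>n u\<close> and \<open>y\<^sub>n v\<close> converge to \<open>a\<close> and \<open>b\<close>, so the generalized limits
  \<open>x'\<close> and \<open>y'\<close> of the two subsequences take the required values.\<close>

proposition compact_operators_attain_limits:
  fixes T A :: "'a::complex_normed_vector \<Rightarrow>\<^sub>C\<^sub>L 'a" and y :: "nat \<Rightarrow> 'a \<Rightarrow>\<^sub>C\<^sub>L complex"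
  assumes "reflexive_space TYPE('a)" and T: "T \<in> compact_operators" and A: "A \<in> compact_operators"
    and x: "\<And>n. norm (x n) \<le> 1" and y: "\<And>n. norm (y n) \<le> 1"
    and a: "(\<lambda>n. cblinfun_apply (y n) (cblinfun_apply T (x n))) \<longlonglongrightarrow> a"
    and b: "(\<lambda>n. cblinfun_apply (y n) (cblinfun_apply A (x n))) \<longlonglongrightarrow> b"
  obtains x' y' where "norm x' \<le> 1" "norm y' \<le> 1"
    "cblinfun_apply y' (cblinfun_apply T x') = a" "cblinfun_apply y' (cblinfun_apply A x') = b"
proof -
  obtain r u where r: "strict_mono (r :: nat \<Rightarrow> nat)" "(\<lambda>n. cblinfun_apply T (x (r n))) \<longlonglongrightarrow> u"
    using compact_operator_convergent_subsequence[OF T x] .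
  obtain r' v where r': "strict_mono (r' :: nat \<Rightarrow> nat)"
    and v: "(\<lambda>n. cblinfun_apply A (x (r (r' n)))) \<longlonglongrightarrow> v"
    using compact_operator_convergent_subsequence[OF A, of "\<lambda>n. x (r n)"] x by blast
  have u: "(\<lambda>n. cblinfun_apply T (x (r (r' n)))) \<longlonglongrightarrow> u"
    using LIMSEQ_subseq_LIMSEQ[OF r(2) r'] by (simp add: o_def)
  have s: "strict_mono (\<lambda>n. r (r' n))" using r(1) r' by (simp add: strict_mono_def)
  obtain x' where x': "norm x' \<le> 1" "cblinfun_apply T x' = u" "cblinfun_apply A x' = v"
    using reflexive_common_limit[OF assms(1), of "\<lambda>n. x (r (r' n))"] x u v by metis
  obtain y' where y': "norm y' \<le> 1"
    "\<And>z l. (\<lambda>n. cblinfun_apply (y (r (r' n))) z) \<longlonglongrightarrow> l \<Longrightarrow> cblinfun_apply y' z = l"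
    using generalized_limit_functional[of "\<lambda>n. y (r (r' n))"] y by blast
  have "cblinfun_apply y' u = a"
    using LIMSEQ_subseq_LIMSEQ[OF a s] by (intro y'(2) functional_values_limit[OF y u]) (simp add: o_def)
  moreover have "cblinfun_apply y' v = b"
    using LIMSEQ_subseq_LIMSEQ[OF b s] by (intro y'(2) functional_values_limit[OF y v]) (simp add: o_def)
  ultimately show thesis using that x' y'(1) by blast
qed

section \<open>Norming values\<close>

definition norming_values ::
    "('a::complex_normed_vector \<Rightarrow>\<^sub>C\<^sub>L 'a) \<Rightarrow> ('a \<Rightarrow>\<^sub>C\<^sub>L 'a) \<Rightarrow> complex set"
  where "norming_values T A = {cblinfun_apply y (cblinfun_apply A x) |x y.
    x \<in> norm_attainment_set T \<and> y \<in> support_functionals (cblinfun_apply T x)}"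

text \<open>The single equation \<open>y(Tx) = \<parallel>T\<parallel>\<close> on the two unit balls forces both \<open>\<parallel>Tx\<parallel> = \<parallel>T\<parallel>\<close> and \<open>\<parallel>y\<parallel> = 1\<close>.
  In this form the condition passes to limits.\<close>

lemma norming_values_eq:
  fixes T A :: "'a::complex_normed_vector \<Rightarrow>\<^sub>C\<^sub>L 'a"
  assumes "T \<noteq> 0"
  shows "norming_values T A = {cblinfun_apply y (cblinfun_apply A x) |x y.
    norm x \<le> 1 \<and> norm y \<le> 1 \<and> cblinfun_apply y (cblinfun_apply T x) = complex_of_real (norm T)}"
proof -
  have "(x \<in> norm_attainment_set T \<and> y \<in> support_functionals (cblinfun_apply T x)) \<longleftrightarrow>
    (norm x \<le> 1 \<and> norm y \<le> 1 \<and> cblinfun_apply y (cblinfun_apply T x) = complex_of_real (norm T))"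
    (is "?L \<longleftrightarrow> ?R") for x y
  proof
    assume ?L
    then show ?R by (simp add: norm_attainment_set_def support_functionals_def)
  next
    assume R: ?R
    have Tx: "norm (cblinfun_apply T x) \<le> norm T"
      using R by (intro norm_cblinfun_apply_le) auto
    have le: "norm T \<le> norm y * norm (cblinfun_apply T x)"
      using R norm_cblinfun_apply[of y "cblinfun_apply T x"] by simp
    have "norm y * norm (cblinfun_apply T x) \<le> norm (cblinfun_apply T x)"
      using R by (simp add: mult_left_le_one_le)
    then have eq: "norm (cblinfun_apply T x) = norm T" using Tx le by simp
    then have "norm T * 1 \<le> norm T * norm y" using le by (simp add: mult.commute)
    moreover have "0 < norm T" using \<open>T \<noteq> 0\<close> by simp
    ultimately have "norm y = 1" using R by (meson mult_le_cancel_left_pos order_antisym)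
    then show ?L using R eq by (simp add: norm_attainment_set_def support_functionals_def)
  qed
  then show ?thesis unfolding norming_values_def by simp
qed

lemma compact_norming_values:
  fixes T A :: "'a::complex_normed_vector \<Rightarrow>\<^sub>C\<^sub>L 'a"
  assumes refl: "reflexive_space TYPE('a)"
    and T: "T \<in> compact_operators" and A: "A \<in> compact_operators" and "T \<noteq> 0"
  shows "compact (norming_values T A)"
  unfolding compact_eq_bounded_closed
proof
  show "bounded (norming_values T A)"
  proof (rule boundedI[where B = "norm A"])
    fix w assume "w \<in> norming_values T A"
    then obtain x y where "w = cblinfun_apply y (cblinfun_apply A x)" "norm x \<le> 1" "norm y \<le> 1"
      unfolding norming_values_eq[OF \<open>T \<noteq> 0\<close>] by auto
    moreover have "norm (cblinfun_apply A x) \<le> norm A"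
      using \<open>norm x \<le> 1\<close> by (simp add: norm_cblinfun_apply_le)
    ultimately show "norm w \<le> norm A"
      using norm_cblinfun_apply[of y "cblinfun_apply A x"]
      by (smt (verit) mult_left_le_one_le norm_ge_zero)
  qed
  show "closed (norming_values T A)"
    unfolding closed_sequential_limits
  proof (intro allI impI, elim conjE)
    fix w l assume w: "\<forall>n. w n \<in> norming_values T A" and l: "w \<longlonglongrightarrow> l"
    have "\<forall>n. \<exists>x y. norm x \<le> 1 \<and> norm y \<le> 1 \<and> w n = cblinfun_apply y (cblinfun_apply A x) \<and>
      cblinfun_apply y (cblinfun_apply T x) = complex_of_real (norm T)"
      using w unfolding norming_values_eq[OF \<open>T \<noteq> 0\<close>] by blast
    then obtain x y where xy: "\<And>n. norm (x n) \<le> 1" "\<And>n. norm (y n) \<le> 1"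
      "\<And>n. w n = cblinfun_apply (y n) (cblinfun_apply A (x n))"
      "\<And>n. cblinfun_apply (y n) (cblinfun_apply T (x n)) = complex_of_real (norm T)"
      by metis
    obtain x' y' where "norm x' \<le> 1" "norm y' \<le> 1"
      "cblinfun_apply y' (cblinfun_apply T x') = complex_of_real (norm T)"
      "cblinfun_apply y' (cblinfun_apply A x') = l"
      by (rule compact_operators_attain_limits[OF refl T A, of x y "complex_of_real (norm T)" l])
        (use l xy(1,2) in \<open>simp_all add: xy(4) flip: xy(3)\<close>)
    then show "l \<in> norming_values T A"
      unfolding norming_values_eq[OF \<open>T \<noteq> 0\<close>] by blast
  qed
qed

section \<open>Orthogonality and norming values\<close>

text \<open>For a single norming value \<open>y(Ax)\<close> the left-hand side is the modulus of \<open>y((T + c A)x)\<close>; the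
  set of \<open>z\<close> satisfying the inequality is convex.\<close>

lemma norm_perturbed_ge_hull_value:
  fixes T A :: "'a::complex_normed_vector \<Rightarrow>\<^sub>C\<^sub>L 'a"
  assumes "z \<in> convex hull (norming_values T A)"
  shows "cmod (complex_of_real (norm T) + c * z) \<le> norm (T + c *\<^sub>C A)"
proof -
  have "convex hull (norming_values T A) \<subseteq>
    {z. cmod (complex_of_real (norm T) + c * z) \<le> norm (T + c *\<^sub>C A)}" (is "_ \<subseteq> ?S")
  proof (rule hull_minimal)
    show "norming_values T A \<subseteq> ?S"
    proof
      fix w assume "w \<in> norming_values T A"
      then obtain x y where xy: "norm x \<le> 1" "norm y = 1" "w = cblinfun_apply y (cblinfun_apply A x)"
        "cblinfun_apply y (cblinfun_apply T x) = complex_of_real (norm T)"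
        by (auto simp: norming_values_def norm_attainment_set_def support_functionals_def)
      have "complex_of_real (norm T) + c * w = cblinfun_apply y (cblinfun_apply (T + c *\<^sub>C A) x)"
        by (simp add: xy(3,4) cblinfun_add_apply scaleC_cblinfun_apply cblinfun_apply_add
            cblinfun_apply_scaleC scaleC_complex_def)
      then have "cmod (complex_of_real (norm T) + c * w) \<le> norm (cblinfun_apply (T + c *\<^sub>C A) x)"
        using norm_cblinfun_apply[of y "cblinfun_apply (T + c *\<^sub>C A) x"] by (simp add: xy)
      also have "\<dots> \<le> norm (T + c *\<^sub>C A)" by (simp add: norm_cblinfun_apply_le xy)
      finally show "w \<in> ?S" by simp
    qed
    show "convex ?S"
    proof (rule convexI)
      fix z w and s t :: real
      assume zw: "z \<in> ?S" "w \<in> ?S" and st: "0 \<le> s" "0 \<le> t" "s + t = 1"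
      have "complex_of_real (norm T) + c * (s *\<^sub>R z + t *\<^sub>R w) =
        s *\<^sub>R (complex_of_real (norm T) + c * z) + t *\<^sub>R (complex_of_real (norm T) + c * w)"
        using st(3) by (simp add: algebra_simps flip: scaleR_add_left)
      moreover have "cmod \<dots> \<le> norm (T + c *\<^sub>C A)"
        using convexD[OF convex_cball[of 0 "norm (T + c *\<^sub>C A)"], of _ _ s t] zw st by simp
      ultimately show "s *\<^sub>R z + t *\<^sub>R w \<in> ?S" by simp
    qed
  qed
  then show ?thesis using assms by blast
qed

lemma approx_BJ_orthogonalI_norming_values:
  assumes z: "z \<in> convex hull (norming_values T A)" "cmod z \<le> \<epsilon> * norm A"
  shows "approx_BJ_orthogonal \<epsilon> T A"
  unfolding approx_BJ_orthogonal_def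
proof
  fix c
  define d where "d = \<epsilon> * norm (c *\<^sub>C A)"
  have "cmod (c * z) \<le> d"
    using mult_left_mono[OF z(2) norm_ge_zero[of c]] by (simp add: d_def norm_mult norm_scaleC ac_simps)
  then have ge: "norm T - d \<le> norm (T + c *\<^sub>C A)"
    using norm_perturbed_ge_hull_value[OF z(1), of c]
      norm_diff_ineq[of "complex_of_real (norm T)" "c * z"] by simp
  \<comment> \<open>If \<open>d > \<parallel>T\<parallel>\<close>, the lower bound \<open>\<parallel>T\<parallel> - d\<close> is negative and cannot be squared, but then
    the left-hand side is at most zero.\<close>
  have "(norm T)\<^sup>2 - 2 * norm T * d \<le> (norm (T + c *\<^sub>C A))\<^sup>2"
  proof (cases "d \<le> norm T")
    case True
    then have "(norm T - d)\<^sup>2 \<le> (norm (T + c *\<^sub>C A))\<^sup>2"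
      using ge by (intro power_mono) auto
    then show ?thesis by (simp add: power2_diff) (smt (verit) zero_le_power2)
  next
    case False
    then have "norm T * norm T \<le> norm T * d" by (intro mult_left_mono) auto
    then have "(norm T)\<^sup>2 - 2 * norm T * d \<le> 0"
      unfolding power2_eq_square using zero_le_square[of "norm T"] by linarith
    then show ?thesis using zero_le_power2[of "norm (T + c *\<^sub>C A)"] by linarith
  qed
  then show "(norm T)\<^sup>2 - 2 * \<epsilon> * norm T * norm (c *\<^sub>C A) \<le> (norm (T + c *\<^sub>C A))\<^sup>2"
    by (simp add: d_def ac_simps)
qed

lemma nearly_norming_vector:
  assumes "0 < e"
  obtains x where "norm x \<le> 1" "norm S - e \<le> norm (cblinfun_apply S x)"
proof (rule ccontr)
  assume "\<not> thesis"
  then have small: "\<And>x. norm x \<le> 1 \<Longrightarrow> norm (cblinfun_apply S x) < norm S - e"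
    using that by (meson not_le)
  have "norm S \<le> norm S - e"
  proof (rule norm_cblinfun_le)
    show "0 \<le> norm S - e" using small[of 0] by (smt (verit) norm_ge_zero norm_zero)
    fix x
    show "norm (cblinfun_apply S x) \<le> (norm S - e) * norm x"
    proof (cases "x = 0")
      case True
      then show ?thesis using norm_cblinfun_apply[of S x] by simp
    next
      case False
      have "norm (cblinfun_apply S (sgn x)) \<le> norm S - e"
        using small[of "sgn x"] False by (simp add: norm_sgn)
      moreover have "norm (cblinfun_apply S (sgn x)) = norm (cblinfun_apply S x) / norm x"
        by (simp add: sgn_div_norm divide_inverse mult.commute
            linear_scale[OF bounded_linear.linear[OF bounded_linear_cblinfun_apply]])
      ultimately show ?thesis using False by (simp add: field_simps)
    qed
  qed
  then show False using assms by simp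
qed

text \<open>The first-order condition in the direction \<open>\<mu>\<close>. Take \<open>t\<^sub>n \<rightarrow> 0\<close> and a pair \<open>(x\<^sub>n, y\<^sub>n)\<close> norming
  \<open>S\<^sub>n = T + t\<^sub>n \<mu> A\<close> up to \<open>t\<^sub>n\<^sup>2\<close>. Since \<open>Re (y\<^sub>n(T x\<^sub>n)) \<le> \<parallel>T\<parallel>\<close>, the growth
  \<open>\<parallel>S\<^sub>n\<parallel> - \<parallel>T\<parallel>\<close> must come from \<open>t\<^sub>n Re (\<mu> y\<^sub>n(A x\<^sub>n))\<close>, and orthogonality bounds it from below by about
  \<open>- \<epsilon> t\<^sub>n \<parallel>A\<parallel>\<close>. An error of order \<open>t\<^sub>n\<^sup>2\<close> is harmless after division by \<open>t\<^sub>n\<close>.\<close>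

lemma approx_BJ_orthogonal_norming_value:
  fixes T A :: "'a::complex_normed_vector \<Rightarrow>\<^sub>C\<^sub>L 'a"
  assumes refl: "reflexive_space TYPE('a)"
    and T: "T \<in> compact_operators" and A: "A \<in> compact_operators" and "T \<noteq> 0"
    and orth: "approx_BJ_orthogonal \<epsilon> T A" and \<mu>: "cmod \<mu> = 1"
  obtains w where "w \<in> norming_values T A" "- (\<epsilon> * norm A) \<le> Re (\<mu> * w)"
proof -
  define t where "t n = inverse (real (Suc n))" for n
  have t_pos: "0 < t n" for n by (simp add: t_def)
  have t_lim: "t \<longlonglongrightarrow> 0" unfolding t_def by (rule LIMSEQ_inverse_real_of_nat)
  define S where "S n = T + (complex_of_real (t n) * \<mu>) *\<^sub>C A" for n
  have normA: "norm ((complex_of_real (t n) * \<mu>) *\<^sub>C A) = t n * norm A" for n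
    using t_pos[of n] by (simp add: norm_scaleC norm_mult \<mu>)
  have N: "0 < norm T" using \<open>T \<noteq> 0\<close> by simp
  have "\<forall>n. \<exists>x. norm x \<le> 1 \<and> norm (S n) - (t n)\<^sup>2 \<le> norm (cblinfun_apply (S n) x)"
    using nearly_norming_vector t_pos by (metis zero_less_power)
  then obtain x where x: "\<And>n. norm (x n) \<le> 1"
    "\<And>n. norm (S n) - (t n)\<^sup>2 \<le> norm (cblinfun_apply (S n) (x n))" by metis
  have "\<forall>n. \<exists>y :: 'a \<Rightarrow>\<^sub>C\<^sub>L complex. norm y \<le> 1 \<and>
      cblinfun_apply y (cblinfun_apply (S n) (x n)) = complex_of_real (norm (cblinfun_apply (S n) (x n)))"
    using norming_functional by metis
  then obtain y :: "nat \<Rightarrow> 'a \<Rightarrow>\<^sub>C\<^sub>L complex" where y: "\<And>n. norm (y n) \<le> 1"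
    "\<And>n. cblinfun_apply (y n) (cblinfun_apply (S n) (x n)) =
      complex_of_real (norm (cblinfun_apply (S n) (x n)))" by metis
  define p where "p n = cblinfun_apply (y n) (cblinfun_apply T (x n))" for n
  define q where "q n = cblinfun_apply (y n) (cblinfun_apply A (x n))" for n
  have value_le: "cmod (cblinfun_apply (y n) (cblinfun_apply B (x n))) \<le> norm B" for n B
    using norm_cblinfun_apply[of "y n" "cblinfun_apply B (x n)"]
      mult_right_mono[OF y(1)[of n] norm_ge_zero[of "cblinfun_apply B (x n)"]]
      norm_cblinfun_apply_le[of B "norm B" "x n"] x(1)[of n] by simp
  have p_le: "cmod (p n) \<le> norm T" and q_le: "cmod (q n) \<le> norm A" for n
    by (simp_all add: p_def q_def value_le)
  have split: "p n + complex_of_real (t n) * (\<mu> * q n) =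
    complex_of_real (norm (cblinfun_apply (S n) (x n)))" for n
    unfolding y(2)[symmetric] by (simp add: p_def q_def S_def cblinfun_add_apply
        scaleC_cblinfun_apply cblinfun_apply_add cblinfun_apply_scaleC scaleC_complex_def)
  have Re_split: "norm (S n) - (t n)\<^sup>2 \<le> Re (p n) + t n * Re (\<mu> * q n)" for n
    using x(2)[of n] arg_cong[OF split[of n], of Re] by simp
  have S_lim: "(\<lambda>n. norm (S n)) \<longlonglongrightarrow> norm T"
  proof -
    have "(\<lambda>n. (complex_of_real (t n) * \<mu>) *\<^sub>C A) \<longlonglongrightarrow> 0"
      by (rule tendsto_norm_zero_cancel) (use tendsto_mult_left_zero[OF t_lim] in \<open>simp add: normA\<close>)
    then show ?thesis
      unfolding S_def using tendsto_norm[OF tendsto_add[OF tendsto_const[of T]]] by fastforce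
  qed
  have p_ge: "norm (S n) - (t n)\<^sup>2 - t n * norm A \<le> Re (p n)" for n
  proof -
    have "Re (\<mu> * q n) \<le> norm A"
      using complex_Re_le_cmod[of "\<mu> * q n"] q_le[of n] by (simp add: norm_mult \<mu>)
    then have "t n * Re (\<mu> * q n) \<le> t n * norm A" using t_pos[of n] by simp
    then show ?thesis using Re_split[of n] by simp
  qed
  have q_ge: "- (2 * \<epsilon> * norm T * norm A) / (norm (S n) + norm T) - t n \<le> Re (\<mu> * q n)" for n
  proof -
    have pos: "0 < norm (S n) + norm T" using N norm_ge_zero[of "S n"] by linarith
    \<comment> \<open>Factoring the difference of squares turns the quadratic bound into one on \<open>\<parallel>S\<^sub>n\<parallel> - \<parallel>T\<parallel>\<close>.\<close>
    have "(norm T)\<^sup>2 - 2 * \<epsilon> * norm T * (t n * norm A) \<le> (norm (S n))\<^sup>2"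
      using orth unfolding approx_BJ_orthogonal_def S_def normA[symmetric] by blast
    then have *: "- (2 * \<epsilon> * norm T * norm A) * t n \<le> (norm (S n) - norm T) * (norm (S n) + norm T)"
      by (simp add: algebra_simps power2_eq_square)
    define k where "k = - (2 * \<epsilon> * norm T * norm A) / (norm (S n) + norm T)"
    have "k * t n \<le> norm (S n) - norm T"
      using * pos by (simp add: k_def field_simps)
    moreover have "Re (p n) \<le> norm T" using complex_Re_le_cmod[of "p n"] p_le[of n] by simp
    ultimately have "(k - t n) * t n \<le> Re (\<mu> * q n) * t n"
      using Re_split[of n] by (simp add: algebra_simps power2_eq_square)
    then show ?thesis using t_pos[of n] unfolding k_def by (simp only: mult_le_cancel_right_pos)
  qed
  have "seq_compact (cball (0 :: complex) (norm T) \<times> cball (0 :: complex) (norm A))"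
    by (intro compact_imp_seq_compact compact_Times compact_cball)
  moreover have "\<forall>n. (p n, q n) \<in> cball 0 (norm T) \<times> cball 0 (norm A)"
    using p_le q_le by simp
  ultimately obtain l r where r: "strict_mono (r :: nat \<Rightarrow> nat)"
    and l: "l \<in> cball 0 (norm T) \<times> cball 0 (norm A)" "((\<lambda>n. (p n, q n)) \<circ> r) \<longlonglongrightarrow> l"
    by (rule seq_compactE) blast
  obtain P Q where PQ: "l = (P, Q)" by (cases l)
  have P: "(\<lambda>n. p (r n)) \<longlonglongrightarrow> P" and Q: "(\<lambda>n. q (r n)) \<longlonglongrightarrow> Q"
    using tendsto_fst[OF l(2)] tendsto_snd[OF l(2)] by (simp_all add: PQ o_def)
  have t_r: "(\<lambda>n. t (r n)) \<longlonglongrightarrow> 0" and S_r: "(\<lambda>n. norm (S (r n))) \<longlonglongrightarrow> norm T"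
    using LIMSEQ_subseq_LIMSEQ[OF t_lim r] LIMSEQ_subseq_LIMSEQ[OF S_lim r] by (simp_all add: o_def)
  have "P = complex_of_real (norm T)"
  proof (rule complex_eq_of_real_if_Re_ge)
    show "cmod P \<le> norm T" using l(1) PQ by simp
    have "(\<lambda>n. norm (S (r n)) - (t (r n))\<^sup>2 - t (r n) * norm A) \<longlonglongrightarrow> norm T - 0\<^sup>2 - 0 * norm A"
      by (intro tendsto_intros t_r S_r)
    then have "(\<lambda>n. norm (S (r n)) - (t (r n))\<^sup>2 - t (r n) * norm A) \<longlonglongrightarrow> norm T" by simp
    then show "norm T \<le> Re P"
      by (rule LIMSEQ_le[OF _ tendsto_Re[OF P]]) (use p_ge in blast)
  qed
  moreover obtain x' y' where "norm x' \<le> 1" "norm y' \<le> 1"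
    "cblinfun_apply y' (cblinfun_apply T x') = P" "cblinfun_apply y' (cblinfun_apply A x') = Q"
    by (rule compact_operators_attain_limits[OF refl T A, of "\<lambda>n. x (r n)" "\<lambda>n. y (r n)" P Q])
      (use x(1) y(1) P Q in \<open>simp_all add: p_def q_def\<close>)
  ultimately have "Q \<in> norming_values T A"
    unfolding norming_values_eq[OF \<open>T \<noteq> 0\<close>] by blast
  moreover have "- (\<epsilon> * norm A) \<le> Re (\<mu> * Q)"
  proof -
    have "(\<lambda>n. - (2 * \<epsilon> * norm T * norm A) / (norm (S (r n)) + norm T) - t (r n))
        \<longlonglongrightarrow> - (2 * \<epsilon> * norm T * norm A) / (norm T + norm T) - 0"
      by (intro tendsto_intros t_r S_r) (use N in simp)
    moreover have "(\<lambda>n. Re (\<mu> * q (r n))) \<longlonglongrightarrow> Re (\<mu> * Q)"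
      by (intro tendsto_intros Q)
    ultimately have "- (2 * \<epsilon> * norm T * norm A) / (norm T + norm T) - 0 \<le> Re (\<mu> * Q)"
      by (rule LIMSEQ_le) (use q_ge in blast)
    then show ?thesis using N by (simp add: field_simps)
  qed
  ultimately show thesis using that by blast
qed

text \<open>If the nearest point \<open>z\<close> of \<open>K\<close> to the origin were outside the disc, \<open>K\<close> would lie in the half
  plane \<open>Re (cnj z w) \<ge> \<bar>z\<bar>\<^sup>2\<close>, which contradicts the hypothesis in the direction
  \<open>- cnj z / \<bar>z\<bar>\<close>.\<close>

lemma convex_meets_disc:
  fixes K :: "complex set"
  assumes "closed K" "convex K" "0 \<le> r"
    and half_plane: "\<And>\<mu>. cmod \<mu> = 1 \<Longrightarrow> \<exists>w\<in>K. - r \<le> Re (\<mu> * w)"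
  shows "K \<inter> cball 0 r \<noteq> {}"
proof
  assume disj: "K \<inter> cball 0 r = {}"
  have "K \<noteq> {}" using half_plane[of 1] by auto
  define z where "z = closest_point K 0"
  have "z \<in> K" using \<open>closed K\<close> \<open>K \<noteq> {}\<close> by (simp add: z_def closest_point_in_set)
  then have z: "r < cmod z" using disj by auto
  define \<mu> where "\<mu> = - cnj (sgn z)"
  have "cmod \<mu> = 1" using z \<open>0 \<le> r\<close> by (auto simp: \<mu>_def norm_sgn)
  then obtain w where w: "w \<in> K" "- r \<le> Re (\<mu> * w)" using half_plane by blast
  have "inner (0 - z) (w - z) \<le> 0"
    unfolding z_def by (rule closest_point_dot[OF assms(2,1) w(1)])
  then have "cmod z * cmod z \<le> inner z w"
    by (simp add: inner_diff_right power2_norm_eq_inner flip: power2_eq_square)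
  moreover have "0 < cmod z" using z \<open>0 \<le> r\<close> by linarith
  ultimately have "cmod z \<le> inner z w / cmod z" by (simp add: pos_le_divide_eq)
  also have "\<dots> = - Re (\<mu> * w)"
    by (simp add: \<mu>_def sgn_div_norm inner_complex_def field_simps)
  finally show False using z w(2) by simp
qed

theorem corollary4p4:
  fixes T A :: "'a::complex_banach \<Rightarrow>\<^sub>C\<^sub>L 'a" and \<epsilon> :: real
  assumes "reflexive_space TYPE('a)"
    and "T \<in> compact_operators" and "A \<in> compact_operators"
    and "T \<noteq> 0"
    and "0 \<le> \<epsilon>" and "\<epsilon> < 1"
  shows "approx_BJ_orthogonal \<epsilon> T A \<longleftrightarrow>
    convex hull {cblinfun_apply y (cblinfun_apply A x) |x y.
        x \<in> norm_attainment_set T \<and> y \<in> support_functionals (cblinfun_apply T x)}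
      \<inter> cball 0 (\<epsilon> * norm A) \<noteq> {}"
  unfolding norming_values_def[symmetric]
proof
  assume orth: "approx_BJ_orthogonal \<epsilon> T A"
  show "convex hull norming_values T A \<inter> cball 0 (\<epsilon> * norm A) \<noteq> {}"
  proof (rule convex_meets_disc)
    show "closed (convex hull norming_values T A)"
      using assms(1-4) by (intro compact_imp_closed compact_convex_hull compact_norming_values)
    show "\<exists>w\<in>convex hull norming_values T A. - (\<epsilon> * norm A) \<le> Re (\<mu> * w)" if "cmod \<mu> = 1" for \<mu>
      using approx_BJ_orthogonal_norming_value[OF assms(1-4) orth that] hull_subset by (metis subsetD)
  qed (use \<open>0 \<le> \<epsilon>\<close> in auto)
next
  assume "convex hull norming_values T A \<inter> cball 0 (\<epsilon> * norm A) \<noteq> {}"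
  then show "approx_BJ_orthogonal \<epsilon> T A"
    using approx_BJ_orthogonalI_norming_values by fastforce
qed

end
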